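(* Let $m\geq 1$ and $k\geq 2m+1$ be integers. Then there exist a finite simple graph $G$ with $e(G)=km$ and a proper edge-coloring $c$ of $G$ with $\mu(G,c)=1\leq m$ such that $G$ contains no forest with exactly $k$ edges.
   Context: All graphs are finite and simple; $e(G)$ denotes the number of edges of $G$. An edge-coloring is proper if adjacent edges have different colors. For an edge-coloring $c$ of $G$, $\mu(G,c)=\max_\gamma|\{e\in E(G):c(e)=\gamma\}|$ is the size of the largest color class. *)

theory Defs
  imports Main
begin

definition simple_graph :: "'a set \<Rightarrow> 'a set set \<Rightarrow> bool" where
  "simple_graph V E \<longleftrightarrow> finite V \<and> (\<forall>e\<in>E. e \<subseteq> V \<and> card e = 2)"

definition subgraph :: "'a set \<Rightarrow> 'a set set \<Rightarrow> 'a set \<Rightarrow> 'a set set \<Rightarrow> bool" where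
  "subgraph W F V E \<longleftrightarrow> simple_graph W F \<and> W \<subseteq> V \<and> F \<subseteq> E"

(* The list enumerates the vertices of the cycle once; the index is taken modulo
   the length so that the last vertex is joined back to the first. *)
definition cycle :: "'a set set \<Rightarrow> 'a list \<Rightarrow> bool" where
  "cycle E vs \<longleftrightarrow> 3 \<le> length vs \<and> distinct vs \<and>
     (\<forall>i < length vs. {vs ! i, vs ! (Suc i mod length vs)} \<in> E)"

definition forest :: "'a set \<Rightarrow> 'a set set \<Rightarrow> bool" where
  "forest V E \<longleftrightarrow> simple_graph V E \<and> (\<nexists>vs. cycle E vs)"

definition proper_edge_coloring :: "'a set set \<Rightarrow> ('a set \<Rightarrow> 'c) \<Rightarrow> bool" where
  "proper_edge_coloring E c \<longleftrightarrow>
     (\<forall>e\<in>E. \<forall>f\<in>E. e \<noteq> f \<and> e \<inter> f \<noteq> {} \<longrightarrow> c e \<noteq> c f)"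

(* The maximum ranges over all colors, including unused ones, whose classes are
   empty; so it is also meaningful (namely 0) for a graph without edges. *)
definition max_color_class :: "'a set set \<Rightarrow> ('a set \<Rightarrow> 'c) \<Rightarrow> nat" where
  "max_color_class E c = Max (range (\<lambda>\<gamma>. card {e \<in> E. c e = \<gamma>}))"

lemma simple_graph_finite_edges: "simple_graph V E \<Longrightarrow> finite E"
  unfolding simple_graph_def by (meson PowI finite_Pow_iff finite_subset subsetI)

(* Max is applied to a finite set even when there are infinitely many colors. *)
lemma finite_color_class_sizes:
  assumes "finite E"
  shows "finite (range (\<lambda>\<gamma>. card {e \<in> E. c e = \<gamma>}))"
proof (rule finite_subset)
  show "range (\<lambda>\<gamma>. card {e \<in> E. c e = \<gamma>}) \<subseteq> {..card E}"
    using assms by (auto intro!: card_mono)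
qed simp

end

theory Submission
  imports Defs
begin

text \<open>
  A forest on \<open>k\<close> vertices has at most \<open>k - 1\<close> edges, so any graph on \<open>k\<close> vertices is a
  witness as soon as it has exactly \<open>k * m\<close> edges. Such graphs exist precisely because
  \<open>k \<ge> 2 * m + 1\<close> makes \<open>k * m \<le> k * (k - 1) / 2\<close>, the number of edges of the complete graph.
  Giving all edges different colors makes the coloring proper with color classes of size at
  most one; the color classes thus place no constraint on the choice of the edges.

  The forest bound \<open>forest_card_edges_less\<close> is proved by deleting vertices of degree at most
  one, which \<open>forest_has_low_degree_vertex\<close> provides.
\<close>

lemma second_neighbour:
  assumes "simple_graph V E" and "\<not> card {e \<in> E. x \<in> e} \<le> 1"
  obtains y where "{x, y} \<in> E" "y \<noteq> x" "y \<noteq> z"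
proof -
  have "\<not> {e \<in> E. x \<in> e} \<subseteq> {{x, z}}"
    using assms(2) card_mono[of "{{x, z}}" "{e \<in> E. x \<in> e}"] by auto
  then obtain e where e: "e \<in> E" "x \<in> e" "e \<noteq> {x, z}" by auto
  then have "card e = 2" using assms(1) by (auto simp: simple_graph_def)
  then obtain a b where "e = {a, b}" "a \<noteq> b" by (auto simp: card_2_iff)
  with e obtain y where "e = {x, y}" "y \<noteq> x" by auto
  with e show thesis using that[of y] by auto
qed

text \<open>
  The first vertex of a longest path works: all its neighbours lie on the path, and a neighbour
  other than the second vertex of the path would close an initial segment of it to a cycle.
\<close>

lemma forest_has_low_degree_vertex:
  assumes "forest V E" and "V \<noteq> {}"
  shows "\<exists>x\<in>V. card {e \<in> E. x \<in> e} \<le> 1"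
proof (rule ccontr)
  assume "\<not> ?thesis"
  then have deg: "\<not> card {e \<in> E. x \<in> e} \<le> 1" if "x \<in> V" for x using that by blast
  have sg: "simple_graph V E" and acyclic: "\<not> cycle E vs" for vs
    using assms(1) by (auto simp: forest_def)
  have fin: "finite V" using sg by (simp add: simple_graph_def)
  define path where "path vs \<longleftrightarrow> vs \<noteq> [] \<and> distinct vs \<and> set vs \<subseteq> V \<and>
     (\<forall>i. Suc i < length vs \<longrightarrow> {vs ! i, vs ! Suc i} \<in> E)" for vs
  obtain v where "v \<in> V" using assms(2) by blast
  then have "path [v]" by (simp add: path_def)
  moreover have "\<forall>ws. path ws \<longrightarrow> length ws < Suc (card V)"
    using card_mono[OF fin] by (metis path_def distinct_card less_Suc_eq_le)
  ultimately have "\<exists>vs. path vs \<and> (\<forall>ws. path ws \<longrightarrow> length ws \<le> length vs)"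
    by (rule ex_has_greatest_nat)
  then obtain vs where vs: "path vs"
    and longest: "\<And>ws. path ws \<Longrightarrow> length ws \<le> length vs"
    by blast
  have d: "distinct vs" and edges: "\<And>i. Suc i < length vs \<Longrightarrow> {vs ! i, vs ! Suc i} \<in> E"
    using vs by (auto simp: path_def)
  have x: "vs ! 0 \<in> V" using vs by (auto simp: path_def)
  \<comment> \<open>On a one-vertex path \<open>vs ! 1\<close> is an unspecified value; that case is covered as well, since
    \<open>y\<close> then cannot lie on the path, which contradicts maximality.\<close>
  obtain y where y: "{vs ! 0, y} \<in> E" "y \<noteq> vs ! 0" "y \<noteq> vs ! 1"
    using second_neighbour[OF sg deg[OF x]] .
  have "y \<in> set vs"
  proof (rule ccontr)
    assume "y \<notin> set vs"
    moreover have "y \<in> V" using y(1) sg by (auto simp: simple_graph_def)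
    ultimately have "path (y # vs)"
      using vs y(1) by (auto simp: path_def nth_Cons insert_commute split: nat.splits)
    from longest[OF this] show False by simp
  qed
  then obtain j where j: "j < length vs" "vs ! j = y" by (auto simp: in_set_conv_nth)
  have "j \<noteq> 0" "j \<noteq> 1" using y(2,3) j(2) by metis+
  then have "2 \<le> j" by linarith
  have "cycle E (take (Suc j) vs)"
    unfolding cycle_def
  proof (intro conjI allI impI)
    have len: "length (take (Suc j) vs) = Suc j" using j by simp
    show "3 \<le> length (take (Suc j) vs)" using len \<open>2 \<le> j\<close> by simp
    show "distinct (take (Suc j) vs)" using d by simp
    fix i assume "i < length (take (Suc j) vs)"
    then have i: "i < Suc j" using len by simp
    show "{take (Suc j) vs ! i, take (Suc j) vs ! (Suc i mod length (take (Suc j) vs))} \<in> E"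
    proof (cases "i = j")
      case True
      have "{y, vs ! 0} \<in> E" using y(1) by (simp only: insert_commute)
      then show ?thesis using True len j by simp
    next
      case False
      then show ?thesis using len i j(1) edges[of i] by simp
    qed
  qed
  then show False using acyclic by blast
qed

lemma forest_delete_vertex:
  assumes "forest V E"
  shows "forest (V - {x}) {e \<in> E. x \<notin> e}"
  using assms by (auto simp: forest_def simple_graph_def cycle_def)

lemma forest_card_edges_less:
  assumes "forest V E" and "V \<noteq> {}"
  shows "card E < card V"
  using assms
proof (induction "card V" arbitrary: V E rule: less_induct)
  case less
  have sg: "simple_graph V E" using less.prems by (simp add: forest_def)
  then have fin: "finite V" "finite E"
    by (auto simp: simple_graph_def intro: simple_graph_finite_edges[OF sg])
  obtain x where x: "x \<in> V" "card {e \<in> E. x \<in> e} \<le> 1"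
    using forest_has_low_degree_vertex[OF less.prems] by blast
  have cV: "card (V - {x}) < card V" using x fin by (intro psubset_card_mono) auto
  show ?case
  proof (cases "V - {x} = {}")
    case True
    then have "V = {x}" using x by auto
    then have "card e \<le> 1" if "e \<in> E" for e
      using sg that card_mono[of "{x}" e] by (auto simp: simple_graph_def)
    then have "E = {}" using sg by (fastforce simp: simple_graph_def)
    then show ?thesis using \<open>V = {x}\<close> by simp
  next
    case False
    have "card {e \<in> E. x \<notin> e} < card (V - {x})"
      using less.hyps[OF cV forest_delete_vertex[OF less.prems(1)] False] .
    moreover have "card E = card {e \<in> E. x \<in> e} + card {e \<in> E. x \<notin> e}"
      using fin by (subst card_Un_disjoint[symmetric]) (auto intro: arg_cong[of _ _ card])
    ultimately show ?thesis using x cV by linarith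
  qed
qed

lemma max_color_class_inj_on:
  assumes "inj_on c E" and "finite E" and "E \<noteq> {}"
  shows "max_color_class E c = 1"
  unfolding max_color_class_def
proof (rule Max_eqI)
  show "finite (range (\<lambda>\<gamma>. card {e \<in> E. c e = \<gamma>}))"
    by (rule finite_color_class_sizes[OF assms(2)])
next
  fix n assume "n \<in> range (\<lambda>\<gamma>. card {e \<in> E. c e = \<gamma>})"
  then obtain \<gamma> where n: "n = card {e \<in> E. c e = \<gamma>}" by blast
  show "n \<le> 1"
    unfolding n One_nat_def
    by (subst card_le_Suc0_iff_eq) (use assms(1,2) in \<open>auto dest: inj_onD\<close>)
next
  obtain e where "e \<in> E" using assms(3) by blast
  then have "{f \<in> E. c f = c e} = {e}" using assms(1) by (auto simp: inj_on_def)
  then have "1 = card {f \<in> E. c f = c e}" by simp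
  then show "1 \<in> range (\<lambda>\<gamma>. card {e \<in> E. c e = \<gamma>})" by (rule range_eqI)
qed

theorem mainTheorem2:
  fixes m k :: nat
  assumes "m \<ge> 1" and "k \<ge> 2 * m + 1"
  shows "\<exists>(V :: nat set) (E :: nat set set) (c :: nat set \<Rightarrow> nat).
    simple_graph V E \<and> card E = k * m \<and>
    proper_edge_coloring E c \<and>
    max_color_class E c = 1 \<and> max_color_class E c \<le> m \<and>
    \<not> (\<exists>W F. subgraph W F V E \<and> forest W F \<and> card F = k)"
proof -
  define K where "K = {e. e \<subseteq> {..<k} \<and> card e = 2}"
  have "k * (2 * m) \<le> k * (k - 1)" using assms(2) by (intro mult_le_mono2) linarith
  then have "k * m \<le> k * (k - 1) div 2" by linarith
  then have "k * m \<le> card K" by (simp add: K_def n_subsets choose_two)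
  then obtain E where E: "E \<subseteq> K" "card E = k * m" "finite E"
    by (rule obtain_subset_with_card_n)
  have graph: "simple_graph {..<k} E" using E(1) by (auto simp: simple_graph_def K_def)
  have "E \<noteq> {}" using E(2) assms by auto
  obtain c :: "nat set \<Rightarrow> nat" where c: "inj_on c E"
    using finite_imp_inj_to_nat_seg[OF E(3)] by blast
  have "proper_edge_coloring E c"
    using c by (auto simp: proper_edge_coloring_def inj_on_def)
  moreover have "max_color_class E c = 1"
    using max_color_class_inj_on[OF c E(3) \<open>E \<noteq> {}\<close>] .
  moreover have "card F \<noteq> k" if "subgraph W F {..<k} E" "forest W F" for W F
  proof (cases "W = {}")
    case True
    then have "F = {}" using that(2) by (fastforce simp: forest_def simple_graph_def)
    then show ?thesis using assms by auto
  next
    case False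
    have "card W \<le> k" using that(1) card_mono[of "{..<k}" W] by (auto simp: subgraph_def)
    then show ?thesis using forest_card_edges_less[OF that(2) False] by linarith
  qed
  ultimately show ?thesis
    using graph E(2) assms(1) by (intro exI[of _ "{..<k}"] exI[of _ E] exI[of _ c]) auto
qed

end
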